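(* We have \[ \sum_{k = 1}^{\infty} \sum_{j = k}^{\infty} \frac{1}{k^2} \, \frac{1}{j \, 2^j} = \frac{5}{8}\, \zeta(3). \]
   Context: $\zeta$ denotes the Riemann zeta function, so $\zeta(3) = \sum_{n=1}^\infty 1/n^3$. *)

theory Defs
  imports "HOL-Analysis.Analysis"
begin

text \<open>
  The Riemann zeta function for real arguments \<open>s > 1\<close>, given by its Dirichlet series
  (the index is shifted by one). At \<open>s \<le> 1\<close>, where the series diverges, the value is not meaningful.
\<close>

definition zeta :: "real \<Rightarrow> real" where
  "zeta s = (\<Sum>n. 1 / real (Suc n) powr s)"

end

theory Submission
  imports Defs "HOL-Real_Asymp.Real_Asymp"
begin

text \<open>
  Let \<open>F x = (\<Sum>k. 1/k\<^sup>2 * (\<Sum>j\<ge>k. x^j/j))\<close>, so that \<open>F' x = Li\<^sub>2 x / (x * (1-x))\<close> and the sum in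
  question is \<open>F (1/2)\<close>. By Landen's identity for the dilogarithm, the function
  \<open>2 * F x + 3 * Li\<^sub>3 (-x/(1-x)) + Li\<^sub>3 x - Li\<^sub>3 (1-x) + ln (1-x) * (Li\<^sub>2 (1-x) - Li\<^sub>2 x)
    - ln (1-x)^3 / 2 + ln x * ln (1-x)^2 / 2\<close>
  has derivative zero on \<open>(0, 1/2)\<close>. Its value is \<open>-\<zeta>(3)\<close> at \<open>0\<close> and \<open>2 * F (1/2) - 9/4 * \<zeta>(3)\<close> at
  \<open>1/2\<close>, where every term with a logarithm or with \<open>Li\<^sub>2(1/2)\<close>, \<open>Li\<^sub>3(1/2)\<close> cancels.
\<close>

section \<open>Polylogarithms: series, derivatives, continuity and values at 1 and -1\<close>

text \<open>For \<open>s \<ge> 1\<close> the summand at \<open>n = 0\<close> vanishes because \<open>x / 0 = 0\<close>.\<close>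
definition polylog :: "nat \<Rightarrow> real \<Rightarrow> real" where
  "polylog s x = (\<Sum>n. 1 / real n ^ s * x ^ n)"

lemma summable_polylog:
  assumes "\<bar>x\<bar> < 1"
  shows "summable (\<lambda>n. 1 / real n ^ s * x ^ n)"
proof (rule summable_comparison_test')
  show "summable (\<lambda>n. \<bar>x\<bar> ^ n)"
    using assms by (simp add: summable_geometric)
  show "norm (1 / real n ^ s * x ^ n) \<le> \<bar>x\<bar> ^ n" if "n \<ge> 1" for n
  proof -
    have "1 \<le> real n ^ s" using that by simp
    then have "1 / real n ^ s * \<bar>x\<bar> ^ n \<le> 1 * \<bar>x\<bar> ^ n"
      by (intro mult_right_mono) (auto simp: divide_le_eq_1)
    then show ?thesis by (simp add: abs_mult power_abs)
  qed
qed

lemma polylog_0: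
  assumes "s \<ge> 1"
  shows "polylog s 0 = 0"
proof -
  have "1 / real n ^ s * 0 ^ n = 0" for n
    using assms by (cases n) (simp_all add: power_0_left)
  then show ?thesis
    by (simp only: polylog_def suminf_zero)
qed

text \<open>The term at n = 0 vanishes, so a factor x can be taken out. The shifted series is the
  one that termwise differentiation produces, both for \<open>polylog (Suc s)\<close> and for
  F.\<close>

lemma polylog_shift:
  assumes "\<bar>x\<bar> < 1" "x \<noteq> 0" "s \<ge> 1"
  shows "(\<lambda>n. x ^ n / real (Suc n) ^ s) sums (polylog s x / x)"
proof -
  have "(\<lambda>n. 1 / real n ^ s * x ^ n) sums polylog s x"
    unfolding polylog_def by (rule summable_sums[OF summable_polylog[OF assms(1)]])
  then have "(\<lambda>n. x * (x ^ n / real (Suc n) ^ s)) sums polylog s x"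
    using assms(3) sums_Suc_iff[of "\<lambda>n. 1 / real n ^ s * x ^ n" "polylog s x"] by (simp add: power_0_left)
  from sums_divide[OF this, of x] show ?thesis
    using assms(2) by simp
qed

lemma polylog_1:
  assumes "\<bar>x\<bar> < 1"
  shows "polylog 1 x = - ln (1 - x)"
proof -
  \<comment> \<open>The expansion of ln around 1 is used at the point 1 - x, where its alternating
    signs cancel against the powers of -x.\<close>
  have "(-1) ^ n * (1 / real (n + 1)) * (1 - x - 1) ^ Suc n = - (1 / real (Suc n) * x ^ Suc n)" for n
  proof -
    have "(-1) ^ n * (1 - x - 1) ^ Suc n = - (x ^ Suc n)"
      using power_mult_distrib[of "-1" "- x" n] by simp
    then show ?thesis
      by (simp add: divide_simps)
  qed
  then have "ln (1 - x) = (\<Sum>n. - (1 / real (Suc n) * x ^ Suc n))"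
    using ln_series[of "1 - x"] assms by (simp only:)
  moreover have "(\<lambda>n. 1 / real (Suc n) * x ^ Suc n) sums polylog 1 x"
    using summable_sums[OF summable_polylog[OF assms, of 1]]
    by (subst sums_Suc_iff) (simp add: polylog_def)
  from sums_unique[OF sums_minus[OF this]]
  have "- polylog 1 x = (\<Sum>n. - (1 / real (Suc n) * x ^ Suc n))" .
  ultimately show ?thesis
    by simp
qed

lemma polylog_has_real_derivative:
  assumes "\<bar>x\<bar> < 1" "x \<noteq> 0" "s \<ge> 1"
  shows "(polylog (Suc s) has_real_derivative polylog s x / x) (at x)"
proof -
  \<comment> \<open>The midpoint of |x| and 1: convergence at \<open>K\<close> justifies termwise
    differentiation at x.\<close>
  define K where "K = (1 + \<bar>x\<bar>) / 2"
  have K: "\<bar>K\<bar> < 1" "norm x < norm K"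
    using assms by (auto simp: K_def)
  have "((\<lambda>x. \<Sum>n. 1 / real n ^ Suc s * x ^ n) has_real_derivative
          (\<Sum>n. diffs (\<lambda>n. 1 / real n ^ Suc s) n * x ^ n)) (at x)"
    by (rule termdiffs_strong[OF summable_polylog[OF K(1)] K(2)])
  moreover have "diffs (\<lambda>n. 1 / real n ^ Suc s) n * x ^ n = x ^ n / real (Suc n) ^ s" for n
    unfolding diffs_def by (simp del: of_nat_Suc)
  moreover have "(\<Sum>n. x ^ n / real (Suc n) ^ s) = polylog s x / x"
    using polylog_shift[OF assms] by (rule sums_unique[symmetric])
  ultimately show ?thesis
    by (simp add: polylog_def[abs_def])
qed

text \<open>At t = 0 and t = 1/2 the arguments 1 - t and -t/(1-t) reach 1 and -1, so continuity is
  needed up to the boundary of the interval of convergence. There the convergent series of 1/n^s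
  dominates uniformly.\<close>

lemma continuous_on_polylog:
  assumes "s \<ge> 2"
  shows "continuous_on {-1..1} (polylog s)"
proof -
  have "uniform_limit {-1..1} (\<lambda>N x. \<Sum>n<N. 1 / real n ^ s * x ^ n) (polylog s) sequentially"
    unfolding polylog_def
  proof (rule Weierstrass_m_test)
    show "summable (\<lambda>n. 1 / real n ^ s)"
      using inverse_power_summable[OF assms, where 'a = real] by (simp add: field_simps)
    show "norm (1 / real n ^ s * x ^ n) \<le> 1 / real n ^ s" if "x \<in> {-1..1}" for n x
    proof -
      have "\<bar>x\<bar> ^ n \<le> 1" using that by (intro power_le_one) auto
      then have "1 / real n ^ s * \<bar>x\<bar> ^ n \<le> 1 / real n ^ s * 1"
        by (intro mult_left_mono) auto
      then show ?thesis by (simp add: abs_mult power_abs)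
    qed
  qed
  then show ?thesis
    by (rule uniform_limit_theorem[rotated])
      (auto intro!: always_eventually continuous_on_sum continuous_on_mult_left continuous_intros
        simp del: times_divide_eq_left)
qed

lemma polylog_3_1: "polylog 3 1 = zeta 3"
proof -
  have "summable (\<lambda>n. 1 / real n ^ 3)"
    using inverse_power_summable[of 3, where 'a = real] by (simp add: field_simps)
  from suminf_split_head[OF this] show ?thesis
    by (simp add: polylog_def zeta_def powr_numeral del: of_nat_Suc)
qed

text \<open>Adding the series at \<open>1\<close> and \<open>-1\<close> leaves twice its even-indexed part, i.e. \<open>1/4\<close> of the series.\<close>
lemma polylog_3_minus_1: "polylog 3 (-1) = - 3 / 4 * zeta 3"
proof -
  have s: "summable (\<lambda>n. 1 / real n ^ 3)"
    using inverse_power_summable[of 3, where 'a = real] by (simp add: field_simps)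
  have s': "summable (\<lambda>n. 1 / real n ^ 3 * (-1) ^ n)"
    by (rule summable_rabs_cancel) (use s in \<open>simp add: abs_mult\<close>)
  have z: "(\<lambda>n. 1 / real n ^ 3) sums zeta 3"
    using summable_sums[OF s] polylog_3_1 by (simp add: polylog_def)
  have m: "(\<lambda>n. 1 / real n ^ 3 * (-1) ^ n) sums polylog 3 (-1)"
    using summable_sums[OF s'] by (simp add: polylog_def)
  define f where "f = (\<lambda>n. 1 / real n ^ 3 + 1 / real n ^ 3 * (-1) ^ n)"
  have "f sums (zeta 3 + polylog 3 (-1))"
    unfolding f_def by (rule sums_add[OF z m])
  moreover have "(\<lambda>n. f (2 * n)) sums (1 / 4 * zeta 3)"
    using sums_mult[OF z, of "1/4"] by (simp add: f_def power_mult_distrib)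
  moreover have "(\<lambda>n. f (2 * n)) sums (1 / 4 * zeta 3) \<longleftrightarrow> f sums (1 / 4 * zeta 3)"
  proof (rule sums_mono_reindex)
    show "strict_mono (\<lambda>n::nat. 2 * n)" by (simp add: strict_mono_def)
    show "f n = 0" if "n \<notin> range (\<lambda>n::nat. 2 * n)" for n
    proof -
      have "odd n" using that by (metis dvdE rangeI)
      then show ?thesis by (simp add: f_def)
    qed
  qed
  ultimately show ?thesis
    using sums_unique2 by fastforce
qed

section \<open>Landen's identity for the dilogarithm\<close>

text \<open>The left-hand side vanishes at 0 and has derivative zero. The bound t < 1/2 keeps
  -t/(1-t) inside (-1, 0), where the defining series can be differentiated.\<close>

lemma polylog_2_landen:
  assumes "0 < t" "t < 1 / 2"
  shows "polylog 2 (- (t / (1 - t))) + polylog 2 t + (ln (1 - t))\<^sup>2 / 2 = 0"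
proof -
  define h where "h = (\<lambda>t. polylog 2 (- (t / (1 - t))) + polylog 2 t + (ln (1 - t))\<^sup>2 / 2)"
  have "continuous_on {0..t} h"
    unfolding h_def using assms
    by (auto intro!: continuous_intros continuous_on_compose2[OF continuous_on_polylog] simp: field_simps)
  moreover have "(h has_real_derivative 0) (at x)" if "0 < x" "x < t" for x
  proof -
    have x: "x < 1 / 2" "\<bar>x\<bar> < 1" "\<bar>- (x / (1 - x))\<bar> < 1" "x \<noteq> 0" "- (x / (1 - x)) \<noteq> 0"
      using that assms by (auto simp: field_simps)
    have e: "1 + x / (1 - x) = inverse (1 - x)"
      using x by (simp add: field_simps)
    have p: "(polylog 2 has_real_derivative polylog 1 y / y) (at y)" if "\<bar>y\<bar> < 1" "y \<noteq> 0" for y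
      using polylog_has_real_derivative[OF that, of 1] by (simp add: numeral_2_eq_2)
    have u: "((\<lambda>x. - (x / (1 - x))) has_real_derivative - (1 / (1 - x)\<^sup>2)) (at x)"
      using x by (auto intro!: derivative_eq_intros simp: field_simps power2_eq_square)
    have l: "((\<lambda>x. (ln (1 - x))\<^sup>2 / 2) has_real_derivative ln (1 - x) * (- 1 / (1 - x))) (at x)"
      using x by (auto intro!: derivative_eq_intros simp: field_simps)
    note d = DERIV_add[OF DERIV_add[OF DERIV_chain2[OF p[OF x(3,5)] u] p[OF x(2,4)]] l, folded h_def]
    have lnu: "ln (1 + x / (1 - x)) = - ln (1 - x)"
      unfolding e using x by (simp add: ln_inverse)
    \<comment> \<open>Here z stands for ln (1 - x): both values of \<open>polylog 1\<close> are plus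
      or minus this logarithm, so only the partial fraction 1/(x(1-x)) = 1/x + 1/(1-x) remains to be
      checked.\<close>
    have cancel: "z / (- (x / (1 - x))) * - (1 / (1 - x)\<^sup>2) + - z / x + z * (- 1 / (1 - x)) = 0" for z
    proof -
      have "z / (- (x / (1 - x))) * - (1 / (1 - x)\<^sup>2) = z / (x * (1 - x))"
        using x by (simp add: power2_eq_square)
      also have "\<dots> = z / x + z / (1 - x)"
        using x by (simp add: field_simps)
      finally show ?thesis by simp
    qed
    have "polylog 1 (- (x / (1 - x))) = ln (1 - x)"
      using polylog_1[OF x(3)] lnu by simp
    then show ?thesis
      by (intro DERIV_cong[OF d]) (simp only: polylog_1[OF x(2)] cancel)
  qed
  ultimately have "h t = h 0"
    using DERIV_isconst_end[of 0 t h] assms by simp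
  then show ?thesis by (simp add: h_def polylog_0)
qed

section \<open>Tails of the logarithm series and the function F\<close>

text \<open>The tail of the series of -ln (1 - x) from index k on, in a closed form that can be
  differentiated directly. The summand at j = 0 is 0 because division by 0 gives 0.\<close>

definition log_tail :: "nat \<Rightarrow> real \<Rightarrow> real" where
  "log_tail k x = - ln (1 - x) - (\<Sum>j<k. x ^ j / real j)"

lemma log_tail_0: "log_tail k 0 = 0"
proof -
  have "0 ^ j / real j = 0" for j
    by (cases j) simp_all
  then show ?thesis
    by (simp only: log_tail_def sum.neutral_const) simp
qed

lemma log_tail_sums:
  assumes "\<bar>x\<bar> < 1"
  shows "(\<lambda>i. x ^ (k + i) / real (k + i)) sums log_tail k x"
proof -
  have "(\<lambda>n. x ^ n / real n) sums (- ln (1 - x))"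
    using summable_sums[OF summable_polylog[OF assms, of 1]] polylog_1[OF assms]
    by (simp add: polylog_def)
  from sums_split_initial_segment[OF this, of k] show ?thesis
    by (simp add: log_tail_def add.commute)
qed

text \<open>Removing one more term of the series subtracts x^m from the derivative, and x^m/(1-x) -
  x^m = x^(m+1)/(1-x).\<close>

lemma log_tail_has_real_derivative:
  assumes "x < 1"
  shows "(log_tail (Suc m) has_real_derivative x ^ m / (1 - x)) (at x)"
proof (induction m)
  case 0
  show ?case
    unfolding log_tail_def using assms by (auto intro!: derivative_eq_intros)
next
  case (Suc m)
  have e: "log_tail (Suc (Suc m)) = (\<lambda>x. log_tail (Suc m) x - x ^ Suc m / real (Suc m))"
    by (simp add: log_tail_def fun_eq_iff)
  have "((\<lambda>x. x ^ Suc m / real (Suc m)) has_real_derivative x ^ m) (at x)"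
    using DERIV_cdivide[OF DERIV_pow[of "Suc m" x UNIV], of "real (Suc m)"] by (simp del: of_nat_Suc)
  from DERIV_diff[OF Suc this] show ?case
    unfolding e by (rule DERIV_cong) (use assms in \<open>simp add: field_simps\<close>)
qed

text \<open>On [0, 1/2] the factor 1/(1-x) is at most 2, so the differentiated series is dominated
  by 2/(m+1)^2 and converges uniformly. Including the endpoints makes F continuous up to
  1/2.\<close>

lemma log_tail_series:
  obtains F where
    "\<And>x. x \<in> {0..1/2} \<Longrightarrow> (\<lambda>m. 1 / real (Suc m) ^ 2 * log_tail (Suc m) x) sums F x"
    "\<And>x. x \<in> {0..1/2} \<Longrightarrow>
      (F has_real_derivative (\<Sum>m. 1 / real (Suc m) ^ 2 * (x ^ m / (1 - x)))) (at x within {0..1/2})"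
proof -
  let ?f = "\<lambda>m x. 1 / real (Suc m) ^ 2 * log_tail (Suc m) x"
  let ?f' = "\<lambda>m x. 1 / real (Suc m) ^ 2 * (x ^ m / (1 - x))"
  have "\<exists>F. \<forall>x\<in>{0..1/2}. (\<lambda>m. ?f m x) sums F x \<and>
      (F has_real_derivative (\<Sum>m. ?f' m x)) (at x within {0..1/2})"
  proof (rule has_field_derivative_series)
    show "(?f m has_real_derivative ?f' m x) (at x within {0..1/2})" if "x \<in> {0..1/2}" for m x
      using that
      by (intro DERIV_cmult has_field_derivative_at_within[OF log_tail_has_real_derivative]) auto
    show "uniform_limit {0..1/2} (\<lambda>n x. \<Sum>i<n. ?f' i x) (\<lambda>x. \<Sum>m. ?f' m x) sequentially"
    proof (rule Weierstrass_m_test)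
      have "summable (\<lambda>n. 1 / real n ^ 2)"
        using inverse_power_summable[of 2, where 'a = real] by (simp add: field_simps)
      then have "summable (\<lambda>n. 1 / real (Suc n) ^ 2)"
        by (subst summable_Suc_iff)
      from summable_mult2[OF this] show "summable (\<lambda>n. 1 / real (Suc n) ^ 2 * 2)" .
      show "norm (?f' m x) \<le> 1 / real (Suc m) ^ 2 * 2" if "x \<in> {0..1/2}" for m x
      proof -
        have "x ^ m / (1 - x) \<le> 1 / (1 / 2)"
          using that by (intro frac_le power_le_one) auto
        moreover have "0 \<le> x ^ m / (1 - x)"
          using that by auto
        ultimately have "\<bar>x ^ m / (1 - x)\<bar> \<le> 2" by (subst abs_of_nonneg) auto
        then show ?thesis
          unfolding real_norm_def abs_mult by (intro mult_mono) (simp_all only:, auto)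
      qed
    qed
    \<comment> \<open>Convergence of the original series at a single point suffices; at 0 all tails
      vanish.\<close>
    show "summable (\<lambda>m. ?f m 0)" by (simp add: log_tail_0)
  qed auto
  then obtain F where F: "\<forall>x\<in>{0..1/2}. (\<lambda>m. ?f m x) sums F x \<and>
      (F has_real_derivative (\<Sum>m. ?f' m x)) (at x within {0..1/2})" ..
  show ?thesis
    by (rule that[of F]) (use F in \<open>simp_all only: ball_simps\<close>)
qed

section \<open>Constancy of the combination and its evaluation at 1/2\<close>

text \<open>The value at \<open>0\<close> is the limit \<open>0\<close> because \<open>ln 0 = 0\<close> and \<open>ln 1 = 0\<close>.\<close>
lemma ln_mult_ln_square_continuous:
  "continuous_on {0..1/2} (\<lambda>t::real. ln t * (ln (1 - t))\<^sup>2)"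
  unfolding continuous_on_def
proof
  fix t :: real assume t: "t \<in> {0..1/2}"
  show "((\<lambda>t. ln t * (ln (1 - t))\<^sup>2) \<longlongrightarrow> ln t * (ln (1 - t))\<^sup>2) (at t within {0..1/2})"
  proof (cases "t = 0")
    case True
    have "((\<lambda>t::real. ln t * (ln (1 - t))\<^sup>2) \<longlongrightarrow> 0) (at_right 0)"
      by real_asymp
    then have "((\<lambda>t::real. ln t * (ln (1 - t))\<^sup>2) \<longlongrightarrow> 0) (at 0 within {0..1/2})"
      by (simp add: at_within_Icc_at_right)
    then show ?thesis using True by simp
  next
    case False
    then show ?thesis using t by (auto intro!: tendsto_intros)
  qed
qed

lemma log_tail_series_half:
  "(\<lambda>m. 1 / real (Suc m) ^ 2 * log_tail (Suc m) (1 / 2)) sums (5 / 8 * zeta 3)"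
proof -
  obtain F where F: "\<And>x. x \<in> {0..1/2} \<Longrightarrow> (\<lambda>m. 1 / real (Suc m) ^ 2 * log_tail (Suc m) x) sums F x"
    and F': "\<And>x. x \<in> {0..1/2} \<Longrightarrow>
      (F has_real_derivative (\<Sum>m. 1 / real (Suc m) ^ 2 * (x ^ m / (1 - x)))) (at x within {0..1/2})"
    by (rule log_tail_series) blast
  define P where "P = (\<lambda>t. 2 * F t + 3 * polylog 3 (- (t / (1 - t))) + polylog 3 t - polylog 3 (1 - t)
    + ln (1 - t) * (polylog 2 (1 - t) - polylog 2 t) - ln (1 - t) ^ 3 / 2 + (ln t * (ln (1 - t))\<^sup>2) / 2)"
  have "continuous_on {0..1/2} F"
    using F' by (rule DERIV_continuous_on)
  moreover have c: "continuous_on {0..1/2} (\<lambda>t. polylog s (g t))"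
    if "s \<ge> 2" "continuous_on {0..1/2} g" "g ` {0..1/2} \<subseteq> {-1..1}" for s and g :: "real \<Rightarrow> real"
    using continuous_on_compose2[OF continuous_on_polylog that(2,3)] that(1) .
  ultimately have cont_P: "continuous_on {0..1/2} P"
    unfolding P_def
    by (intro continuous_on_add continuous_on_diff continuous_on_mult continuous_on_divide continuous_on_power c
        continuous_on_const ln_mult_ln_square_continuous continuous_on_ln continuous_on_id continuous_on_minus)
      (auto simp: field_simps)
  have deriv_P: "(P has_real_derivative 0) (at x)" if "0 < x" "x < 1 / 2" for x
  proof -
    have x: "\<bar>x\<bar> < 1" "x \<noteq> 0" "\<bar>- (x / (1 - x))\<bar> < 1" "- (x / (1 - x)) \<noteq> 0" "\<bar>1 - x\<bar> < 1" "1 - x \<noteq> 0"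
      using that by (auto simp: field_simps)
    have p2: "(polylog 2 has_real_derivative - ln (1 - y) / y) (at y)" if "\<bar>y\<bar> < 1" "y \<noteq> 0" for y
      using polylog_has_real_derivative[OF that, of 1] polylog_1[OF that(1)] by (simp add: numeral_2_eq_2)
    have p3: "(polylog 3 has_real_derivative polylog 2 y / y) (at y)" if "\<bar>y\<bar> < 1" "y \<noteq> 0" for y
      using polylog_has_real_derivative[OF that, of 2] by simp
    have "(\<Sum>m. 1 / real (Suc m) ^ 2 * (x ^ m / (1 - x))) = polylog 2 x / (x * (1 - x))"
      using sums_divide[OF polylog_shift[OF x(1,2), of 2], of "1 - x"]
      by (intro sums_unique[symmetric]) (simp add: mult.commute)
    moreover have "at x within {0..1/2} = at x"
      using that by (intro at_within_Icc_at) auto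
    ultimately have dF: "(F has_real_derivative polylog 2 x / (x * (1 - x))) (at x)"
      using F'[of x] that by simp
    have u: "((\<lambda>x. - (x / (1 - x))) has_real_derivative - (1 / (1 - x)\<^sup>2)) (at x)"
      using x by (auto intro!: derivative_eq_intros simp: field_simps power2_eq_square)
    have v: "((\<lambda>x. 1 - x) has_real_derivative - 1) (at x)"
      by (auto intro!: derivative_eq_intros)
    have l: "((\<lambda>x. ln (1 - x)) has_real_derivative - 1 / (1 - x)) (at x)"
            "((\<lambda>x. ln (1 - x) ^ 3) has_real_derivative 3 * (ln (1 - x))\<^sup>2 * (- 1 / (1 - x))) (at x)"
            "((\<lambda>x. (ln (1 - x))\<^sup>2) has_real_derivative 2 * ln (1 - x) * (- 1 / (1 - x))) (at x)"
      using that by (auto intro!: derivative_eq_intros)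
    note d = DERIV_add[OF DERIV_diff[OF DERIV_add[OF DERIV_diff[OF DERIV_add[OF DERIV_add[OF
        DERIV_cmult[OF dF, of 2] DERIV_cmult[OF DERIV_chain2[OF p3[OF x(3,4)] u], of 3]]
        p3[OF x(1,2)]] DERIV_chain2[OF p3[OF x(5,6)] v]]
        DERIV_mult[OF l(1) DERIV_diff[OF DERIV_chain2[OF p2[OF x(5,6)] v] p2[OF x(1,2)]]]]
        DERIV_cdivide[OF l(2), of 2]]
        DERIV_cdivide[OF DERIV_mult[OF DERIV_ln_divide[OF that(1)] l(3)], of 2], folded P_def]
    \<comment> \<open>Landen's identity leaves only dilogarithms at x and 1 - x. Partial fractions
      then turn every term into a multiple of 1/x or 1/(1-x), and the coefficients cancel.\<close>
    have L: "polylog 2 (- (x / (1 - x))) = - polylog 2 x - (ln (1 - x))\<^sup>2 / 2"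
      using polylog_2_landen[OF that] by simp
    have e: "z / (x * (1 - x)) = z / x + z / (1 - x)" for z
      using x by (simp add: field_simps)
    have e': "z / (- (x / (1 - x))) * - (1 / (1 - x)\<^sup>2) = z / x + z / (1 - x)" for z
      unfolding e[symmetric] using x by (simp add: power2_eq_square)
    \<comment> \<open>Naming 1 - x keeps it atomic while the simplifier expands differences and
      quotients.\<close>
    define y where "y = 1 - x"
    have y: "1 - y = x" by (simp add: y_def)
    show ?thesis
      by (rule DERIV_cong[OF d], unfold L e', unfold e, fold y_def)
        (simp add: y algebra_simps power2_eq_square add_divide_distrib diff_divide_distrib)
  qed
  have "P (1 / 2) = P 0"
    by (rule DERIV_isconst_end[OF _ cont_P deriv_P]) auto
  moreover have "(\<lambda>m. 0) sums F 0"
    using F[of 0] by (simp add: log_tail_0)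
  then have "F 0 = 0"
    by (rule sums_unique2[OF _ sums_zero])
  then have "P 0 = - zeta 3"
    by (simp add: P_def polylog_3_1 polylog_0)
  \<comment> \<open>At 1/2 the argument -t/(1-t) equals -1, so -9/4 is 3 * (-3/4). The other
    polylogarithms cancel since t = 1 - t, and the two cubes of ln (1/2) cancel each other.\<close>
  moreover have "P (1 / 2) = 2 * F (1 / 2) - 9 / 4 * zeta 3"
    by (simp add: P_def polylog_3_minus_1 power2_eq_square power3_eq_cube)
  ultimately have "F (1 / 2) = 5 / 8 * zeta 3" by simp
  with F[of "1 / 2"] show ?thesis by simp
qed

theorem corollary6p2:
  shows "(\<forall>k\<ge>1. summable (\<lambda>i. 1 / real k ^ 2 * (1 / (real (k + i) * 2 ^ (k + i))))) \<and>
    (\<lambda>m. let k = Suc m in \<Sum>i. 1 / real k ^ 2 * (1 / (real (k + i) * 2 ^ (k + i))))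
      sums (5 / 8 * zeta 3)"
proof -
  \<comment> \<open>At x = 1/2 the tail has the terms 1/(j * 2^j) with j = k + i, so each inner sum
    is a summand of the series for F (1/2).\<close>
  have s: "(\<lambda>i. 1 / real k ^ 2 * (1 / (real (k + i) * 2 ^ (k + i)))) sums
      (1 / real k ^ 2 * log_tail k (1 / 2))" for k
    using sums_mult[OF log_tail_sums[of "1 / 2" k], of "1 / real k ^ 2"]
    by (simp add: power_one_over mult.commute)
  show ?thesis
  proof (intro conjI allI impI)
    show "summable (\<lambda>i. 1 / real k ^ 2 * (1 / (real (k + i) * 2 ^ (k + i))))" for k
      by (rule sums_summable[OF s])
    show "(\<lambda>m. let k = Suc m in \<Sum>i. 1 / real k ^ 2 * (1 / (real (k + i) * 2 ^ (k + i))))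
      sums (5 / 8 * zeta 3)"
      unfolding Let_def sums_unique[OF s, symmetric] by (rule log_tail_series_half)
  qed
qed

end
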